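(* The sampling modes $(O,R)$, $(O,\overline{R})$ and $(\overline{O},\overline{R})$ are pairwise incomparable. That is, for any two distinct modes $(\alpha,\beta)$ and $(\alpha',\beta')$ among these three, there exist a concept-class triple $(C,Z,\models)$ and a MAP-learner $L$ for it with $\mathrm{MAP\text{-}TD}^{\alpha,\beta}_L(C)>\mathrm{MAP\text{-}TD}^{\alpha',\beta'}_L(C)$.
   Context: A concept-class triple $(C,Z,\models)$ consists of a finite set $C$ with $|C|\ge 2$ (the concept class), a non-empty finite set $Z$ (the observations) and a relation $\models$ on $C\times Z$ (consistency). Sampling modes are pairs $(\alpha,\beta)\in\{O,\overline{O}\}\times\{R,\overline{R}\}$ (ordered/unordered, with/without replacement). $\mathcal{Z}^{O,R}$ is the set of finite sequences over $Z$; $\mathcal{Z}^{\overline{O},R}$ the set of finite multisets over $Z$; $\mathcal{Z}^{O,\overline{R}}$ the set of repetition-free sequences over $Z$; $\mathcal{Z}^{\overline{O},\overline{R}}=2^Z$. The empty sequence/multiset/set is included and denoted $\emptyset$; $|I|$ is the length of a sequence or the cardinality (with multiplicity) of a (multi)set. For a probability vector $Q=(q(z))_{z\in Z}$: $P^{O,R}((z_1,\dots,z_n)|Q)=\prod_{i=1}^n q(z_i)$; for a repetition-free sequence with $n\le|\{z:q(z)>0\}|$, $P^{O,\overline{R}}((z_1,\dots,z_n)|Q)=\prod_{i=1}^n \frac{q(z_i)}{1-(q(z_1)+\dots+q(z_{i-1}))}$; for a set $A=\{z_1,\dots,z_n\}$ of size $n\le|\{z:q(z)>0\}|$, $P^{\overline{O},\overline{R}}(A|Q)=\sum_\sigma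 P^{O,\overline{R}}((z_{\sigma(1)},\dots,z_{\sigma(n)})|Q)$ over all permutations $\sigma$ of $\{1,\dots,n\}$. The probability of $\emptyset$ is $1$ in every mode. A MAP-learner $L$ for $(C,Z,\models)$ is given by priors $P(c)>0$ with $\sum_{c\in C}P(c)=1$ and conditional likelihoods $P(z|c)\ge 0$ with $\sum_{z\in Z}P(z|c)=1$ for each $c\in C$, subject to the validity condition: $c\not\models z$ implies $P(z|c)=0$. Write $P^{\alpha,\beta}(I|c)$ for $P^{\alpha,\beta}(I|P(\cdot|c))$ and $N^+(C,L)=\min_{c\in C}|\{z\in Z:P(z|c)>0\}|$. A teacher for $L$ in mode $(\alpha,\beta)$ is a map $T:C\to\mathcal{Z}^{\alpha,\beta}$ such that for every $c_0\in C$: if $\beta=\overline{R}$ then $|T(c_0)|\le N^+(C,L)$; and $c_0$ is the unique maximizer over $c\in C$ of $P(c)\cdot P^{\alpha,\beta}(T(c_0)|c)$. The order of $T$ is $\max_{c\in C}|T(c)|$. $\mathrm{MAP\text{-}TD}^{\alpha,\beta}_L(C)$ is the smallest order of a teacher for $L$ in mode $(\alpha,\beta)$, or $\infty$ if no teacher exists. Mode $(\alpha,\beta)$ dominates mode $(\alpha',\beta')$ if $\mathrm{MAP\text{-}TD}^{\alpha,\beta}_L(C)\le\mathrm{MAP\text{-}TD}^{\alpha',\beta'}_L(C)$ for every concept-class triple and every MAP-learner $L$ for it; two modes are incomparable if neither dominates the other. *)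

theory Defs
  imports Complex_Main "HOL-Library.Extended_Nat" "HOL-Combinatorics.Multiset_Permutations"
begin

definition concept_class_triple :: "'c set \<Rightarrow> 'z set \<Rightarrow> ('c \<Rightarrow> 'z \<Rightarrow> bool) \<Rightarrow> bool" where
  "concept_class_triple C Z models \<longleftrightarrow> finite C \<and> card C \<ge> 2 \<and> finite Z \<and> Z \<noteq> {}"

datatype order_mode = Ordered | Unordered

datatype replacement_mode = Replacement | NoReplacement

type_synonym sampling_mode = "order_mode \<times> replacement_mode"

text \<open>
  One type for the samples of all four modes: sequences (repetition-free or not),
  multisets and sets.  The carrier for each mode is fixed by \<open>samples\<close>.
\<close>

datatype 'z sample = Sequence "'z list" | Multiset "'z multiset" | Subset "'z set"

fun samples :: "'z set \<Rightarrow> sampling_mode \<Rightarrow> 'z sample set" where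
  "samples Z (Ordered, Replacement) = {Sequence zs |zs. set zs \<subseteq> Z}"
| "samples Z (Unordered, Replacement) = {Multiset M |M. set_mset M \<subseteq> Z}"
| "samples Z (Ordered, NoReplacement) = {Sequence zs |zs. set zs \<subseteq> Z \<and> distinct zs}"
| "samples Z (Unordered, NoReplacement) = {Subset A |A. A \<subseteq> Z}"

fun sample_size :: "'z sample \<Rightarrow> nat" where
  "sample_size (Sequence zs) = length zs"
| "sample_size (Multiset M) = size M"
| "sample_size (Subset A) = card A"

definition seq_prob :: "('z \<Rightarrow> real) \<Rightarrow> 'z list \<Rightarrow> real" where
  "seq_prob q zs = (\<Prod>i<length zs. q (zs ! i))"

text \<open>
  Only meaningful for repetition-free sequences whose length is at most the number
  of observations of positive probability; then no denominator vanishes.  The size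
  bound in \<open>teacher\<close> below guarantees this wherever the value matters.
\<close>

definition distinct_seq_prob :: "('z \<Rightarrow> real) \<Rightarrow> 'z list \<Rightarrow> real" where
  "distinct_seq_prob q zs = (\<Prod>i<length zs. q (zs ! i) / (1 - (\<Sum>j<i. q (zs ! j))))"

text \<open>
  The probability of an unordered sample is the total probability of its orderings;
  for multisets this is the multinomial probability.  A sample whose shape does not
  belong to the mode gets the dummy value 0.
\<close>

fun sample_prob :: "sampling_mode \<Rightarrow> ('z \<Rightarrow> real) \<Rightarrow> 'z sample \<Rightarrow> real" where
  "sample_prob (Ordered, Replacement) q (Sequence zs) = seq_prob q zs"
| "sample_prob (Unordered, Replacement) q (Multiset M) =
     (\<Sum>zs\<in>permutations_of_multiset M. seq_prob q zs)"
| "sample_prob (Ordered, NoReplacement) q (Sequence zs) = distinct_seq_prob q zs"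
| "sample_prob (Unordered, NoReplacement) q (Subset A) =
     (\<Sum>zs\<in>permutations_of_set A. distinct_seq_prob q zs)"
| "sample_prob _ q _ = 0"

text \<open>A learner is given by its priors \<open>P(c)\<close> and its conditional likelihoods \<open>P(z|c)\<close>.\<close>

record ('c, 'z) learner =
  prior :: "'c \<Rightarrow> real"
  likelihood :: "'c \<Rightarrow> 'z \<Rightarrow> real"

definition map_learner ::
  "'c set \<Rightarrow> 'z set \<Rightarrow> ('c \<Rightarrow> 'z \<Rightarrow> bool) \<Rightarrow> ('c, 'z) learner \<Rightarrow> bool" where
  "map_learner C Z models L \<longleftrightarrow>
     (\<forall>c\<in>C. prior L c > 0) \<and> (\<Sum>c\<in>C. prior L c) = 1 \<and>
     (\<forall>c\<in>C. \<forall>z\<in>Z. likelihood L c z \<ge> 0) \<and>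
     (\<forall>c\<in>C. (\<Sum>z\<in>Z. likelihood L c z) = 1) \<and>
     (\<forall>c\<in>C. \<forall>z\<in>Z. \<not> models c z \<longrightarrow> likelihood L c z = 0)"

definition N_plus :: "'c set \<Rightarrow> 'z set \<Rightarrow> ('c, 'z) learner \<Rightarrow> nat" where
  "N_plus C Z L = Min ((\<lambda>c. card {z \<in> Z. likelihood L c z > 0}) ` C)"

definition unique_maximizer :: "('c \<Rightarrow> real) \<Rightarrow> 'c set \<Rightarrow> 'c \<Rightarrow> bool" where
  "unique_maximizer f C c0 \<longleftrightarrow> (\<forall>c. is_arg_max f (\<lambda>c. c \<in> C) c \<longleftrightarrow> c = c0)"

definition teacher ::
  "'c set \<Rightarrow> 'z set \<Rightarrow> ('c, 'z) learner \<Rightarrow> sampling_mode \<Rightarrow> ('c \<Rightarrow> 'z sample) \<Rightarrow> bool" where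
  "teacher C Z L m T \<longleftrightarrow>
     (\<forall>c0\<in>C. T c0 \<in> samples Z m \<and>
        (snd m = NoReplacement \<longrightarrow> sample_size (T c0) \<le> N_plus C Z L) \<and>
        unique_maximizer (\<lambda>c. prior L c * sample_prob m (likelihood L c) (T c0)) C c0)"

definition teacher_order :: "'c set \<Rightarrow> ('c \<Rightarrow> 'z sample) \<Rightarrow> nat" where
  "teacher_order C T = Max ((\<lambda>c. sample_size (T c)) ` C)"

text \<open>The infimum in \<open>enat\<close> is attained if a teacher exists, and is \<open>\<infinity>\<close> otherwise.\<close>

definition MAP_TD :: "'c set \<Rightarrow> 'z set \<Rightarrow> ('c, 'z) learner \<Rightarrow> sampling_mode \<Rightarrow> enat" where
  "MAP_TD C Z L m = (INF T\<in>{T. teacher C Z L m T}. enat (teacher_order C T))"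

text \<open>
  Concepts and observations are natural numbers here.  Since both carriers are finite,
  every concept-class triple has an isomorphic copy of this form, so this is no restriction.
\<close>

definition dominates :: "sampling_mode \<Rightarrow> sampling_mode \<Rightarrow> bool" where
  "dominates m m' \<longleftrightarrow>
     (\<forall>(C :: nat set) (Z :: nat set) models L.
        concept_class_triple C Z models \<longrightarrow> map_learner C Z models L \<longrightarrow>
        MAP_TD C Z L m \<le> MAP_TD C Z L m')"

definition incomparable :: "sampling_mode \<Rightarrow> sampling_mode \<Rightarrow> bool" where
  "incomparable m m' \<longleftrightarrow> \<not> dominates m m' \<and> \<not> dominates m' m"

end

theory Submission
  imports Defs
begin

text \<open>
  Three small learners suffice, and in each of them the relevant orders are separated by the
  threshold 2, so that only samples with at most two observations have to be inspected.

  \<^item> \<open>repetition_learner\<close>: repeating an observation multiplies its likelihood ratio, while a sample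
    without repetitions from a two-element set has ratio at most 2.  This is too little to
    overcome a prior ratio of 3.
  \<^item> \<open>exclusion_learner\<close>: drawing without replacement from the uniform distributions on two and
    on three observations gives both members of the smaller support with likelihood ratio 3,
    instead of 9/4 with replacement.  The prior ratio 5/2 lies in between.
  \<^item> \<open>order_learner\<close>: against the uniform distribution, the order \<open>(0, 1)\<close> has likelihood ratio 2,
    but the set \<open>{0, 1}\<close> only 7/4.  The prior ratio 15/8 lies in between.

  With two concepts, a set never does better than the best of its orderings (mediant inequality).
  Hence \<open>set_learner\<close> uses two competitors, each of which wins against concept 2 in one of the two
  orders of \<open>{0, 1}\<close>, but loses after summation.
\<close>

lemma unique_maximizer_iff:
  "unique_maximizer f C c0 \<longleftrightarrow> c0 \<in> C \<and> (\<forall>c\<in>C. c \<noteq> c0 \<longrightarrow> f c < f c0)"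
proof
  assume um: "unique_maximizer f C c0"
  then have c0: "c0 \<in> C" and max: "\<And>c. c \<in> C \<Longrightarrow> f c \<le> f c0"
    by (auto simp: unique_maximizer_def is_arg_max_def not_less)
  have "f c < f c0" if c: "c \<in> C" "c \<noteq> c0" for c
  proof (rule ccontr)
    assume "\<not> f c < f c0"
    with max have "is_arg_max f (\<lambda>c. c \<in> C) c"
      using c by (fastforce simp: is_arg_max_def)
    with um c show False by (auto simp: unique_maximizer_def)
  qed
  with c0 show "c0 \<in> C \<and> (\<forall>c\<in>C. c \<noteq> c0 \<longrightarrow> f c < f c0)" by blast
next
  assume "c0 \<in> C \<and> (\<forall>c\<in>C. c \<noteq> c0 \<longrightarrow> f c < f c0)"
  then show "unique_maximizer f C c0"
    unfolding unique_maximizer_def is_arg_max_def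
    by (metis less_asym')
qed

lemma MAP_TD_le:
  assumes "finite C" "C \<noteq> {}" "teacher C Z L m T" "\<And>c. c \<in> C \<Longrightarrow> sample_size (T c) \<le> k"
  shows "MAP_TD C Z L m \<le> enat k"
proof -
  have "teacher_order C T \<le> k"
    using assms by (simp add: teacher_order_def)
  then show ?thesis
    unfolding MAP_TD_def using assms(3) by (intro INF_lower2[of T]) auto
qed

text \<open>A single concept that no sample of size at most \<open>k\<close> singles out blocks
  every teacher of order at most \<open>k\<close>; ties count against it. Without any teacher the
  infimum is infinite, so the strict bound holds there too.\<close>

lemma MAP_TD_greater:
  assumes "finite C" "c0 \<in> C"
    and "\<forall>s\<in>samples Z m. sample_size s \<le> k \<longrightarrow>
      (\<exists>c\<in>C. c \<noteq> c0 \<and> prior L c0 * sample_prob m (likelihood L c0) s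
        \<le> prior L c * sample_prob m (likelihood L c) s)"
  shows "enat k < MAP_TD C Z L m"
proof -
  have "enat (Suc k) \<le> enat (teacher_order C T)" if T: "teacher C Z L m T" for T
  proof -
    have "T c0 \<in> samples Z m" and
      "\<forall>c\<in>C. c \<noteq> c0 \<longrightarrow> prior L c * sample_prob m (likelihood L c) (T c0)
         < prior L c0 * sample_prob m (likelihood L c0) (T c0)"
      using T assms(2) by (auto simp: teacher_def unique_maximizer_iff)
    with assms(3) have "Suc k \<le> sample_size (T c0)"
      by (meson not_less not_less_eq_eq)
    also have "\<dots> \<le> teacher_order C T"
      using assms(1,2) by (simp add: teacher_order_def)
    finally show ?thesis by simp
  qed
  then have "enat (Suc k) \<le> MAP_TD C Z L m"
    unfolding MAP_TD_def by (intro INF_greatest) auto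
  then show ?thesis by (simp add: Suc_ile_eq)
qed

text \<open>Provides the size bound that \<open>teacher\<close> demands of two-element samples drawn
  without replacement.\<close>

lemma N_plus_ge_2:
  assumes "finite C" "C \<noteq> {}" "finite Z"
    and "\<forall>c\<in>C. \<exists>a\<in>Z. \<exists>b\<in>Z. a \<noteq> b \<and> likelihood L c a > 0 \<and> likelihood L c b > 0"
  shows "2 \<le> N_plus C Z L"
proof -
  have "2 \<le> card {z \<in> Z. likelihood L c z > 0}" if c: "c \<in> C" for c
  proof -
    from assms(4) c obtain a b where ab: "a \<in> Z" "b \<in> Z" "a \<noteq> b"
      "likelihood L c a > 0" "likelihood L c b > 0" by blast
    then have "card {a, b} \<le> card {z \<in> Z. likelihood L c z > 0}"
      using assms(3) by (intro card_mono) auto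
    with ab show ?thesis by simp
  qed
  with assms(1,2) show ?thesis by (simp add: N_plus_def)
qed

lemma length_le_2_iff:
  "length xs \<le> 2 \<longleftrightarrow> xs = [] \<or> (\<exists>a. xs = [a]) \<or> (\<exists>a b. xs = [a, b])"
  \<comment> \<open>These cases separate lists of length 0, 1 and at least 2.\<close>
  by (cases xs rule: remdups_adj.cases) auto

lemma seq_prob_small [simp]:
  "seq_prob q [] = 1" "seq_prob q [a] = q a" "seq_prob q [a, b] = q a * q b"
  by (simp_all add: seq_prob_def)

lemma distinct_seq_prob_small [simp]:
  "distinct_seq_prob q [] = 1" "distinct_seq_prob q [a] = q a"
  "distinct_seq_prob q [a, b] = q a * q b / (1 - q a)"
  by (simp_all add: distinct_seq_prob_def)

lemma set_prob_doubleton [simp]: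
  assumes "a \<noteq> b"
  shows "(\<Sum>zs\<in>permutations_of_set {a, b}. distinct_seq_prob q zs)
    = q a * q b / (1 - q a) + q b * q a / (1 - q b)"
  using assms by (simp add: permutations_of_set_doubleton)

text \<open>This and its two analogues replace the quantifier over samples by quantifiers over
  \<open>Z\<close>, which \<open>simp\<close> expands for a concrete \<open>Z\<close>.\<close>

lemma small_samples_OR:
  "(\<forall>s\<in>samples Z (Ordered, Replacement). sample_size s \<le> 2 \<longrightarrow> P s) \<longleftrightarrow>
    P (Sequence []) \<and> (\<forall>a\<in>Z. P (Sequence [a])) \<and> (\<forall>a\<in>Z. \<forall>b\<in>Z. P (Sequence [a, b]))"
  by (auto simp: length_le_2_iff)

lemma small_samples_ON:
  "(\<forall>s\<in>samples Z (Ordered, NoReplacement). sample_size s \<le> 2 \<longrightarrow> P s) \<longleftrightarrow>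
    P (Sequence []) \<and> (\<forall>a\<in>Z. P (Sequence [a])) \<and>
    (\<forall>a\<in>Z. \<forall>b\<in>Z. a \<noteq> b \<longrightarrow> P (Sequence [a, b]))"
  by (auto simp: length_le_2_iff)

lemma small_samples_UN:
  assumes "finite Z"
  shows "(\<forall>s\<in>samples Z (Unordered, NoReplacement). sample_size s \<le> 2 \<longrightarrow> P s) \<longleftrightarrow>
    P (Subset {}) \<and> (\<forall>a\<in>Z. P (Subset {a})) \<and>
    (\<forall>a\<in>Z. \<forall>b\<in>Z. a \<noteq> b \<longrightarrow> P (Subset {a, b}))" (is "?L \<longleftrightarrow> ?R")
proof
  assume ?R
  show ?L
  proof (intro ballI impI)
    fix s assume "s \<in> samples Z (Unordered, NoReplacement)" "sample_size s \<le> 2"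
    then obtain A where A: "s = Subset A" "A \<subseteq> Z" "card A \<le> 2" by auto
    \<comment> \<open>Infinite sets also have \<open>card\<close> 0, so finiteness comes
      first.\<close>
    from A assms have "finite A" by (auto intro: finite_subset)
    moreover from A have "card A = 0 \<or> card A = 1 \<or> card A = 2" by linarith
    ultimately have "A = {} \<or> (\<exists>a. A = {a}) \<or> (\<exists>a b. a \<noteq> b \<and> A = {a, b})"
      by (auto simp: card_1_singleton_iff card_2_iff)
    with A \<open>?R\<close> show "P s" by auto
  qed
qed auto

definition repetition_learner :: "(nat, nat) learner" where
  "repetition_learner = \<lparr>prior = (!) [3/4, 1/4],
     likelihood = (\<lambda>c. (!) ([[2/3, 1/3], [1/3, 2/3]] ! c))\<rparr>"

definition exclusion_learner :: "(nat, nat) learner" where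
  "exclusion_learner = \<lparr>prior = (!) [5/7, 2/7],
     likelihood = (\<lambda>c. (!) ([[1/3, 1/3, 1/3], [1/2, 1/2, 0]] ! c))\<rparr>"

definition order_learner :: "(nat, nat) learner" where
  "order_learner = \<lparr>prior = (!) [15/23, 8/23],
     likelihood = (\<lambda>c. (!) ([[1/3, 1/3, 1/3], [1/2, 1/3, 1/6]] ! c))\<rparr>"

definition set_learner :: "(nat, nat) learner" where
  "set_learner = \<lparr>prior = (!) [1/3, 1/3, 1/3],
     likelihood = (\<lambda>c. (!) ([[3/5, 1/5, 1/5], [1/5, 3/5, 1/5], [2/5, 2/5, 1/5]] ! c))\<rparr>"

lemmas learner_defs = repetition_learner_def exclusion_learner_def order_learner_def set_learner_def

text \<open>The constantly true relation makes the validity condition vacuous.\<close>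

lemma map_learners:
  "map_learner {0, 1} {0, 1} (\<lambda>_ _. True) repetition_learner"
  "map_learner {0, 1} {0, 1, 2} (\<lambda>_ _. True) exclusion_learner"
  "map_learner {0, 1} {0, 1, 2} (\<lambda>_ _. True) order_learner"
  "map_learner {0, 1, 2} {0, 1, 2} (\<lambda>_ _. True) set_learner"
  by (simp_all add: map_learner_def learner_defs)

lemma N_plus_learners:
  "2 \<le> N_plus {0, 1} {0, 1, 2} exclusion_learner"
  "2 \<le> N_plus {0, 1} {0, 1, 2} order_learner"
  "2 \<le> N_plus {0, 1, 2} {0, 1, 2} set_learner"
  by (rule N_plus_ge_2; simp add: learner_defs)+

lemma repetition_learner_MAP_TD:
  "MAP_TD {0, 1} {0, 1} repetition_learner (Ordered, Replacement) \<le> enat 2"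
  "enat 2 < MAP_TD {0, 1} {0, 1} repetition_learner (Ordered, NoReplacement)"
  "enat 2 < MAP_TD {0, 1} {0, 1} repetition_learner (Unordered, NoReplacement)"
proof -
  show "MAP_TD {0, 1} {0, 1} repetition_learner (Ordered, Replacement) \<le> enat 2"
    \<comment> \<open>The empty sample teaches concept 0 by its larger prior; \<open>[1, 1]\<close>
      has likelihood ratio 4, above the prior ratio 3.\<close>
    by (rule MAP_TD_le[where T = "(!) [Sequence [], Sequence [1, 1]]"])
      (auto simp: teacher_def unique_maximizer_iff learner_defs)
  show "enat 2 < MAP_TD {0, 1} {0, 1} repetition_learner (Ordered, NoReplacement)"
    \<comment> \<open>Concept 1 has the smaller prior. The first \<open>simp_all\<close> enumerates
      the samples before the default rules for \<open>samples\<close> can act; the second does the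
      arithmetic.\<close>
    by (rule MAP_TD_greater[where ?c0.0 = 1])
      (simp_all only: small_samples_ON, simp_all add: learner_defs)
  show "enat 2 < MAP_TD {0, 1} {0, 1} repetition_learner (Unordered, NoReplacement)"
    by (rule MAP_TD_greater[where ?c0.0 = 1])
      (simp_all only: small_samples_UN finite.intros, simp_all add: learner_defs)
qed

lemma exclusion_learner_MAP_TD:
  "enat 2 < MAP_TD {0, 1} {0, 1, 2} exclusion_learner (Ordered, Replacement)"
  "MAP_TD {0, 1} {0, 1, 2} exclusion_learner (Ordered, NoReplacement) \<le> enat 2"
  "MAP_TD {0, 1} {0, 1, 2} exclusion_learner (Unordered, NoReplacement) \<le> enat 2"
proof -
  show "enat 2 < MAP_TD {0, 1} {0, 1, 2} exclusion_learner (Ordered, Replacement)"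
    by (rule MAP_TD_greater[where ?c0.0 = 1])
      (simp_all only: small_samples_OR, simp_all add: learner_defs)
  show "MAP_TD {0, 1} {0, 1, 2} exclusion_learner (Ordered, NoReplacement) \<le> enat 2"
    using N_plus_learners(1)
    by (intro MAP_TD_le[where T = "(!) [Sequence [], Sequence [0, 1]]"])
      (auto simp: teacher_def unique_maximizer_iff learner_defs)
  show "MAP_TD {0, 1} {0, 1, 2} exclusion_learner (Unordered, NoReplacement) \<le> enat 2"
    using N_plus_learners(1)
    by (intro MAP_TD_le[where T = "(!) [Subset {}, Subset {0, 1}]"])
      (auto simp: teacher_def unique_maximizer_iff learner_defs)
qed

lemma order_learner_MAP_TD:
  "MAP_TD {0, 1} {0, 1, 2} order_learner (Ordered, NoReplacement) \<le> enat 2"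
  "enat 2 < MAP_TD {0, 1} {0, 1, 2} order_learner (Unordered, NoReplacement)"
proof -
  show "MAP_TD {0, 1} {0, 1, 2} order_learner (Ordered, NoReplacement) \<le> enat 2"
    using N_plus_learners(2)
    by (intro MAP_TD_le[where T = "(!) [Sequence [], Sequence [0, 1]]"])
      (auto simp: teacher_def unique_maximizer_iff learner_defs)
  show "enat 2 < MAP_TD {0, 1} {0, 1, 2} order_learner (Unordered, NoReplacement)"
    by (rule MAP_TD_greater[where ?c0.0 = 1])
      (simp_all only: small_samples_UN finite.intros, simp_all add: learner_defs)
qed

lemma set_learner_MAP_TD:
  "enat 2 < MAP_TD {0, 1, 2} {0, 1, 2} set_learner (Ordered, NoReplacement)"
  "MAP_TD {0, 1, 2} {0, 1, 2} set_learner (Unordered, NoReplacement) \<le> enat 2"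
proof -
  show "enat 2 < MAP_TD {0, 1, 2} {0, 1, 2} set_learner (Ordered, NoReplacement)"
    \<comment> \<open>On \<open>[0, 1]\<close> concept 2 has probability 4/15 against 3/10 for
      concept 0; on \<open>[1, 0]\<close> concept 1 wins likewise.\<close>
    by (rule MAP_TD_greater[where ?c0.0 = 2])
      (simp_all only: small_samples_ON, simp_all add: learner_defs)
  show "MAP_TD {0, 1, 2} {0, 1, 2} set_learner (Unordered, NoReplacement) \<le> enat 2"
    \<comment> \<open>Equal priors make the empty set a tie, so concepts 0 and 1 get their most
      likely observation. On \<open>{0, 1}\<close> concept 2 has 8/15 against 9/20 for each
      rival.\<close>
    using N_plus_learners(3)
    by (intro MAP_TD_le[where T = "(!) [Subset {0}, Subset {1}, Subset {0, 1}]"])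
      (auto simp: teacher_def unique_maximizer_iff learner_defs)
qed

theorem theorem3p12:
  defines "modes \<equiv> {(Ordered, Replacement), (Ordered, NoReplacement), (Unordered, NoReplacement)}"
  shows "pairwise incomparable modes \<and>
    (\<forall>m\<in>modes. \<forall>m'\<in>modes. m \<noteq> m' \<longrightarrow>
       (\<exists>(C :: nat set) (Z :: nat set) models L.
          concept_class_triple C Z models \<and> map_learner C Z models L \<and>
          MAP_TD C Z L m > MAP_TD C Z L m'))"
proof -
  let ?sep = "\<lambda>m m'. \<exists>(C :: nat set) (Z :: nat set) models L.
    concept_class_triple C Z models \<and> map_learner C Z models L \<and>
    MAP_TD C Z L m > MAP_TD C Z L m'"
  have sepI: "?sep m m'"
    if "map_learner C Z (\<lambda>_ _. True) L" "MAP_TD C Z L m' \<le> enat 2" "enat 2 < MAP_TD C Z L m"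
      and "finite C" "2 \<le> card C" "finite Z" "Z \<noteq> {}"
    for C Z :: "nat set" and L m m'
    using that le_less_trans unfolding concept_class_triple_def by blast
  have "?sep (Ordered, NoReplacement) (Ordered, Replacement)"
    by (rule sepI[OF map_learners(1) repetition_learner_MAP_TD(1,2)]) simp_all
  moreover have "?sep (Unordered, NoReplacement) (Ordered, Replacement)"
    by (rule sepI[OF map_learners(1) repetition_learner_MAP_TD(1,3)]) simp_all
  moreover have "?sep (Ordered, Replacement) (Ordered, NoReplacement)"
    by (rule sepI[OF map_learners(2) exclusion_learner_MAP_TD(2,1)]) simp_all
  moreover have "?sep (Ordered, Replacement) (Unordered, NoReplacement)"
    by (rule sepI[OF map_learners(2) exclusion_learner_MAP_TD(3,1)]) simp_all
  moreover have "?sep (Unordered, NoReplacement) (Ordered, NoReplacement)"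
    by (rule sepI[OF map_learners(3) order_learner_MAP_TD]) simp_all
  moreover have "?sep (Ordered, NoReplacement) (Unordered, NoReplacement)"
    by (rule sepI[OF map_learners(4) set_learner_MAP_TD(2,1)]) simp_all
  ultimately have sep: "\<forall>m\<in>modes. \<forall>m'\<in>modes. m \<noteq> m' \<longrightarrow> ?sep m m'"
    unfolding modes_def by (auto simp only: insert_iff empty_iff)
  \<comment> \<open>Incomparability needs this for both orders of a pair, and \<open>sep\<close>
    covers both.\<close>
  have "\<not> dominates m m'" if "?sep m m'" for m m'
    using that unfolding dominates_def by (meson not_less)
  with sep have "pairwise incomparable modes"
    unfolding pairwise_def incomparable_def by metis
  with sep show ?thesis by blast
qed

end
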